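(* Let $\mathcal{P}$ be a two-orbit $n$-polytope in the class $2_I$ with base flag $\Phi$, and $\Gamma=\Gamma(\mathcal{P})$. Then for all $J,K\subseteq N$, \[\Gamma_J\cap\Gamma_K=\Gamma_{J\cup K}\quad\text{and}\quad \Gamma^J\cap\Gamma^K=\Gamma^{J\cap K}.\]
   Context: An (abstract) polytope of rank $n$ is a partially ordered set with a strictly monotone rank function onto $\{-1,\ldots,n\}$, a unique least and unique greatest face, whose maximal chains (flags) each contain $n+2$ faces, satisfying the diamond condition and strong flag-connectedness. For a flag $\Phi$ and $i\in N:=\{0,\ldots,n-1\}$, $\Phi^i$ is the flag differing from $\Phi$ exactly in its $i$-face, $\Phi^{i_1,\ldots,i_l}:=(\Phi^{i_1,\ldots,i_{l-1}})^{i_l}$. $\Gamma(\mathcal{P})$ is the automorphism group (acting on the right). A two-orbit polytope is one whose automorphism group has exactly two flag orbits; it is in class $2_I$ where $I\subsetneq N$ is the (flag-independent) set of $i$ with $\Phi,\Phi^i$ in the same orbit; $\bar I:=N\setminus I$. Given the base flag $\Phi$, for $i\in I$, $j,k\in\bar I$ let $\rho_i,\alpha_{j,k},\alpha_{j,i,j}\in\Gamma$ be the unique automorphisms with $\Phi\rho_i=\Phi^i$, $\Phi\alpha_{j,k}=\Phi^{j,k}$, $\Phi\alpha_{j,i,j}=\Phi^{j,i,j}$. For $J\subseteq N$ with $\bar J:=N\setminus J$, $\Gamma_J:=\langle\rho_i,\alpha_{j,k},\alpha_{j,i,j}\mid i\in I\cap\bar J;\ j,k\in\bar I\cap\bar J\rangle$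 and $\Gamma^J:=\Gamma_{\bar J}$. *)

theory Defs
  imports "HOL-Algebra.Generated_Groups" "HOL-Algebra.Group_Action"
begin

record 'a ranked_poset =
  faces :: "'a set"
  face_le :: "('a \<times> 'a) set"
  rk :: "'a \<Rightarrow> int"

definition face_less :: "'a ranked_poset \<Rightarrow> 'a \<Rightarrow> 'a \<Rightarrow> bool" where
  "face_less P F G \<longleftrightarrow> (F, G) \<in> face_le P \<and> F \<noteq> G"

definition flags :: "'a ranked_poset \<Rightarrow> 'a set set" where
  "flags P = {C \<in> Chains (face_le P). \<forall>D \<in> Chains (face_le P). C \<subseteq> D \<longrightarrow> D = C}"

definition adjacent :: "'a set \<Rightarrow> 'a set \<Rightarrow> bool" where
  "adjacent \<Phi> \<Psi> \<longleftrightarrow> card (\<Phi> - \<Psi>) = 1 \<and> card (\<Psi> - \<Phi>) = 1"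

definition diamond :: "'a ranked_poset \<Rightarrow> bool" where
  "diamond P \<longleftrightarrow>
     (\<forall>F \<in> faces P. \<forall>G \<in> faces P. face_less P F G \<and> rk P G = rk P F + 2 \<longrightarrow>
        card {H \<in> faces P. face_less P F H \<and> face_less P H G} = 2)"

definition strongly_flag_connected :: "'a ranked_poset \<Rightarrow> bool" where
  "strongly_flag_connected P \<longleftrightarrow>
     (\<forall>\<Phi> \<in> flags P. \<forall>\<Psi> \<in> flags P. \<exists>\<Phi>s. \<Phi>s \<noteq> [] \<and> set \<Phi>s \<subseteq> flags P \<and>
        hd \<Phi>s = \<Phi> \<and> last \<Phi>s = \<Psi> \<and> successively adjacent \<Phi>s \<and>
        (\<forall>\<Omega> \<in> set \<Phi>s. \<Phi> \<inter> \<Psi> \<subseteq> \<Omega>))"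

definition polytope :: "int \<Rightarrow> 'a ranked_poset \<Rightarrow> bool" where
  "polytope n P \<longleftrightarrow>
     partial_order_on (faces P) (face_le P) \<and>
     (\<forall>F G. face_less P F G \<longrightarrow> rk P F < rk P G) \<and>
     rk P ` faces P = {-1..n} \<and>
     (\<exists>!F. F \<in> faces P \<and> (\<forall>G \<in> faces P. (F, G) \<in> face_le P)) \<and>
     (\<exists>!F. F \<in> faces P \<and> (\<forall>G \<in> faces P. (G, F) \<in> face_le P)) \<and>
     (\<forall>\<Phi> \<in> flags P. int (card \<Phi>) = n + 2) \<and>
     diamond P \<and>
     strongly_flag_connected P"

abbreviation ranks :: "int \<Rightarrow> int set" where
  "ranks n \<equiv> {0..<n}"

definition adj_flag :: "'a ranked_poset \<Rightarrow> 'a set \<Rightarrow> int \<Rightarrow> 'a set" where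
  "adj_flag P \<Phi> i =
     (THE \<Psi>. \<Psi> \<in> flags P \<and> \<Psi> \<noteq> \<Phi> \<and> {F \<in> \<Psi>. rk P F \<noteq> i} = {F \<in> \<Phi>. rk P F \<noteq> i})"

definition adj_flags :: "'a ranked_poset \<Rightarrow> 'a set \<Rightarrow> int list \<Rightarrow> 'a set" where
  "adj_flags P = foldl (adj_flag P)"

text \<open>Automorphisms act on the right, so the product of \<open>\<gamma>\<close> and \<open>\<delta>\<close> is
  \<open>\<gamma>\<close> followed by \<open>\<delta>\<close>. They are extensional functions on the face set, which makes
  them unique as elements of a function type.\<close>

definition Aut :: "'a ranked_poset \<Rightarrow> ('a \<Rightarrow> 'a) monoid" where
  "Aut P =
     \<lparr>carrier = {\<gamma> \<in> Bij (faces P). \<forall>F \<in> faces P. \<forall>G \<in> faces P.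
                  (\<gamma> F, \<gamma> G) \<in> face_le P \<longleftrightarrow> (F, G) \<in> face_le P},
      mult = (\<lambda>\<gamma> \<delta>. compose (faces P) \<delta> \<gamma>),
      one = (\<lambda>F \<in> faces P. F)\<rparr>"

lemma group_Aut: "group (Aut P)"
proof (rule groupI)
  fix \<gamma> \<delta> assume g: "\<gamma> \<in> carrier (Aut P)" "\<delta> \<in> carrier (Aut P)"
  have m: "\<gamma> F \<in> faces P" if "F \<in> faces P" for F
    using g that by (auto simp: Aut_def Bij_def bij_betw_def)
  show "\<gamma> \<otimes>\<^bsub>Aut P\<^esub> \<delta> \<in> carrier (Aut P)"
    using g m by (auto simp: Aut_def compose_Bij) (auto simp: compose_def)
next
  show "\<one>\<^bsub>Aut P\<^esub> \<in> carrier (Aut P)"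
    by (auto simp: Aut_def id_Bij)
next
  fix \<gamma> \<delta> \<eta>
  assume g: "\<gamma> \<in> carrier (Aut P)" "\<delta> \<in> carrier (Aut P)" "\<eta> \<in> carrier (Aut P)"
  show "\<gamma> \<otimes>\<^bsub>Aut P\<^esub> \<delta> \<otimes>\<^bsub>Aut P\<^esub> \<eta> = \<gamma> \<otimes>\<^bsub>Aut P\<^esub> (\<delta> \<otimes>\<^bsub>Aut P\<^esub> \<eta>)"
    using g by (auto simp: Aut_def compose_def Bij_def bij_betw_def fun_eq_iff)
next
  fix \<gamma> assume g: "\<gamma> \<in> carrier (Aut P)"
  show "\<one>\<^bsub>Aut P\<^esub> \<otimes>\<^bsub>Aut P\<^esub> \<gamma> = \<gamma>"
    using g by (auto simp: Aut_def compose_def Bij_def extensional_def fun_eq_iff)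
  have b: "bij_betw \<gamma> (faces P) (faces P)" "\<gamma> \<in> Bij (faces P)"
    using g by (auto simp: Aut_def Bij_def)
  define \<delta> where "\<delta> = (\<lambda>F \<in> faces P. inv_into (faces P) \<gamma> F)"
  have d: "\<delta> \<in> Bij (faces P)"
    unfolding \<delta>_def using b(2) by (rule restrict_inv_into_Bij)
  have gd: "\<gamma> (\<delta> F) = F" "\<delta> F \<in> faces P" if "F \<in> faces P" for F
    using b(1) that by (auto simp: \<delta>_def bij_betw_def f_inv_into_f inv_into_into)
  have "\<delta> \<in> carrier (Aut P)"
    using g d gd by (simp add: Aut_def) metis
  moreover have "\<delta> \<otimes>\<^bsub>Aut P\<^esub> \<gamma> = \<one>\<^bsub>Aut P\<^esub>"
    using gd by (auto simp: Aut_def compose_def fun_eq_iff)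
  ultimately show "\<exists>\<delta> \<in> carrier (Aut P). \<delta> \<otimes>\<^bsub>Aut P\<^esub> \<gamma> = \<one>\<^bsub>Aut P\<^esub>" by blast
qed

definition two_orbit_polytope :: "int \<Rightarrow> 'a ranked_poset \<Rightarrow> bool" where
  "two_orbit_polytope n P \<longleftrightarrow> polytope n P \<and> card (orbits (Aut P) (flags P) (`)) = 2"

definition in_class_2 :: "int \<Rightarrow> 'a ranked_poset \<Rightarrow> int set \<Rightarrow> bool" where
  "in_class_2 n P I \<longleftrightarrow> two_orbit_polytope n P \<and> I \<subset> ranks n \<and>
     (\<forall>\<Phi> \<in> flags P. I = {i \<in> ranks n. adj_flag P \<Phi> i \<in> orbit (Aut P) (`) \<Phi>})"

definition aut_to :: "'a ranked_poset \<Rightarrow> 'a set \<Rightarrow> 'a set \<Rightarrow> ('a \<Rightarrow> 'a)" where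
  "aut_to P \<Phi> \<Psi> = (THE \<gamma>. \<gamma> \<in> carrier (Aut P) \<and> \<gamma> ` \<Phi> = \<Psi>)"

definition rho :: "'a ranked_poset \<Rightarrow> 'a set \<Rightarrow> int \<Rightarrow> ('a \<Rightarrow> 'a)" where
  "rho P \<Phi> i = aut_to P \<Phi> (adj_flag P \<Phi> i)"

definition alpha2 :: "'a ranked_poset \<Rightarrow> 'a set \<Rightarrow> int \<Rightarrow> int \<Rightarrow> ('a \<Rightarrow> 'a)" where
  "alpha2 P \<Phi> j k = aut_to P \<Phi> (adj_flags P \<Phi> [j, k])"

definition alpha3 :: "'a ranked_poset \<Rightarrow> 'a set \<Rightarrow> int \<Rightarrow> int \<Rightarrow> ('a \<Rightarrow> 'a)" where
  "alpha3 P \<Phi> j i = aut_to P \<Phi> (adj_flags P \<Phi> [j, i, j])"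

definition Gamma_lower ::
    "int \<Rightarrow> 'a ranked_poset \<Rightarrow> int set \<Rightarrow> 'a set \<Rightarrow> int set \<Rightarrow> ('a \<Rightarrow> 'a) set" where
  "Gamma_lower n P I \<Phi> J =
     (let I' = ranks n - I; J' = ranks n - J in
      generate (Aut P)
        ({rho P \<Phi> i | i. i \<in> I \<inter> J'} \<union>
         {alpha2 P \<Phi> j k | j k. j \<in> I' \<inter> J' \<and> k \<in> I' \<inter> J'} \<union>
         {alpha3 P \<Phi> j i | j i. j \<in> I' \<inter> J' \<and> i \<in> I \<inter> J'}))"

definition Gamma_upper ::
    "int \<Rightarrow> 'a ranked_poset \<Rightarrow> int set \<Rightarrow> 'a set \<Rightarrow> int set \<Rightarrow> ('a \<Rightarrow> 'a) set" where
  "Gamma_upper n P I \<Phi> J = Gamma_lower n P I \<Phi> (ranks n - J)"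

end

theory Submission
  imports Defs
begin

text \<open>The subgroup \<open>\<Gamma>\<^sub>J\<close> turns out to be the stabilizer of the faces of the base flag whose ranks
  lie in \<open>J\<close>, and for stabilizers the intersection property is immediate. That the generators
  fix these faces is clear. Conversely, if \<open>\<gamma>\<close> fixes them, strong flag-connectedness yields a
  word over \<open>N - J\<close> leading from \<open>\<Phi>\<close> to \<open>\<Phi>\<gamma>\<close>. Reading the word letter by letter, each flag
  reached is the image under \<open>\<Gamma>\<^sub>J\<close> either of \<open>\<Phi>\<close> or of some \<open>\<Phi>\<^sup>j\<close> with \<open>j \<notin> I\<close>; for the last flag
  the second alternative is excluded by its orbit, and an automorphism is determined by
  the image of a single flag.\<close>

locale abstract_polytope =
  fixes n :: int and P :: "'a ranked_poset"
  assumes polytope: "polytope n P"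
begin

section \<open>Order, rank and chains of faces\<close>

lemma face_order: "face_le P \<subseteq> faces P \<times> faces P" "refl_on (faces P) (face_le P)" "trans (face_le P)"
  using polytope by (simp_all add: polytope_def partial_order_on_def preorder_on_def)

lemma le_faces: "(F, G) \<in> face_le P \<Longrightarrow> F \<in> faces P \<and> G \<in> faces P"
  using face_order(1) by blast

lemma le_refl: "F \<in> faces P \<Longrightarrow> (F, F) \<in> face_le P"
  using face_order(2) by (rule refl_onD)

lemma le_trans: "(F, G) \<in> face_le P \<Longrightarrow> (G, H) \<in> face_le P \<Longrightarrow> (F, H) \<in> face_le P"
  using face_order(3) by (rule transD)

lemma rk_less: "(F, G) \<in> face_le P \<Longrightarrow> F \<noteq> G \<Longrightarrow> rk P F < rk P G"
  using polytope by (auto simp: polytope_def face_less_def)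

lemma rk_bounds: "F \<in> faces P \<Longrightarrow> rk P F \<in> {-1..n}"
  using polytope by (auto simp: polytope_def)

lemma diamondD:
  assumes "F \<in> faces P" "G \<in> faces P" "face_less P F G" "rk P G = rk P F + 2"
  shows "card {H \<in> faces P. face_less P F H \<and> face_less P H G} = 2"
proof -
  have "diamond P" using polytope by (simp add: polytope_def)
  then show ?thesis unfolding diamond_def using assms by blast
qed

lemma ChainsD:
  "C \<in> Chains (face_le P) \<Longrightarrow> F \<in> C \<Longrightarrow> G \<in> C \<Longrightarrow> (F, G) \<in> face_le P \<or> (G, F) \<in> face_le P"
  by (auto simp: Chains_def)

lemma Chains_faces: "C \<in> Chains (face_le P) \<Longrightarrow> C \<subseteq> faces P"
  using le_faces by (fastforce simp: Chains_def)

lemma Chains_inj_rk: "C \<in> Chains (face_le P) \<Longrightarrow> inj_on (rk P) C"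
  by (rule inj_onI) (metis ChainsD less_irrefl rk_less)

lemma Chains_rk_image: "C \<in> Chains (face_le P) \<Longrightarrow> rk P ` C \<subseteq> {-1..n}"
  using Chains_faces rk_bounds by blast

lemma Chains_finite: "C \<in> Chains (face_le P) \<Longrightarrow> finite C"
  by (meson Chains_inj_rk Chains_rk_image finite_atLeastAtMost_int inj_on_finite)

lemma Chains_card:
  assumes "C \<in> Chains (face_le P)" shows "card C \<le> nat (n + 2)"
proof -
  have "card C \<le> card {-1..n}"
    using assms by (intro card_inj_on_le[of "rk P"] Chains_inj_rk Chains_rk_image) auto
  then show ?thesis by simp
qed

text \<open>Cardinalities of chains are bounded, so some chain containing \<open>C\<close> has
  greatest cardinality; as chains are finite, it is maximal under inclusion.\<close>

lemma Chain_subset_flag: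
  assumes "C \<in> Chains (face_le P)"
  obtains \<Phi> where "\<Phi> \<in> flags P" "C \<subseteq> \<Phi>"
proof -
  let ?A = "\<lambda>D. D \<in> Chains (face_le P) \<and> C \<subseteq> D"
  obtain D where D: "?A D" and max: "\<And>E. ?A E \<Longrightarrow> card E \<le> card D"
    using ex_has_greatest_nat[of ?A C card "Suc (nat (n + 2))"] assms Chains_card
    by (auto simp: less_Suc_eq_le)
  have "E = D" if "E \<in> Chains (face_le P)" "D \<subseteq> E" for E
    using card_seteq[OF Chains_finite[OF that(1)] that(2)] max[of E] D that by blast
  then have "D \<in> flags P" using D by (simp add: flags_def)
  then show thesis using that D by blast
qed

section \<open>Flags as chains with one face of each rank\<close>

lemma flag_Chain: "\<Phi> \<in> flags P \<Longrightarrow> \<Phi> \<in> Chains (face_le P)"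
  by (simp add: flags_def)

lemma flag_faces: "\<Phi> \<in> flags P \<Longrightarrow> \<Phi> \<subseteq> faces P"
  by (simp add: flag_Chain Chains_faces)

lemma flag_card: "\<Phi> \<in> flags P \<Longrightarrow> int (card \<Phi>) = n + 2"
  using polytope by (simp add: polytope_def)

lemma flag_rk_unique: "\<Phi> \<in> flags P \<Longrightarrow> F \<in> \<Phi> \<Longrightarrow> G \<in> \<Phi> \<Longrightarrow> rk P F = rk P G \<Longrightarrow> F = G"
  by (meson Chains_inj_rk flag_Chain inj_onD)

text \<open>Such a chain attains the bound in \<open>Chains_card\<close>, so it has no proper
  extension.\<close>

lemma flagI:
  assumes "C \<in> Chains (face_le P)" "int (card C) = n + 2" shows "C \<in> flags P"
proof -
  have "D = C" if "D \<in> Chains (face_le P)" "C \<subseteq> D" for D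
    using card_seteq[OF Chains_finite that(2)] that Chains_card[OF that(1)] assms(2) by force
  then show ?thesis using assms(1) by (simp add: flags_def)
qed

lemma flag_rk_image:
  assumes "\<Phi> \<in> flags P" shows "rk P ` \<Phi> = {-1..n}"
proof (rule card_subset_eq)
  have "card (rk P ` \<Phi>) = card \<Phi>"
    by (intro card_image Chains_inj_rk flag_Chain assms)
  then show "card (rk P ` \<Phi>) = card {-1..n}" using flag_card[OF assms] by simp
qed (simp_all add: Chains_rk_image flag_Chain assms)

lemma flag_face_exists:
  assumes "\<Phi> \<in> flags P" "i \<in> {-1..n}" obtains F where "F \<in> \<Phi>" "rk P F = i"
  using flag_rk_image[OF assms(1)] assms(2) by (metis imageE)

lemma flag_le_iff:
  "\<Phi> \<in> flags P \<Longrightarrow> F \<in> \<Phi> \<Longrightarrow> G \<in> \<Phi> \<Longrightarrow> (F, G) \<in> face_le P \<longleftrightarrow> rk P F \<le> rk P G"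
  by (metis ChainsD flag_Chain linorder_not_less order_less_imp_le rk_less order_refl)

lemma flag_eqI:
  assumes "\<Phi> \<in> flags P" "\<Psi> \<in> flags P" "\<Phi> \<subseteq> \<Psi>" shows "\<Phi> = \<Psi>"
  using assms by (auto simp: flags_def)

lemma flag_contains_least:
  assumes "\<Phi> \<in> flags P" "F \<in> faces P" "\<And>G. G \<in> faces P \<Longrightarrow> (F, G) \<in> face_le P"
  shows "F \<in> \<Phi>"
proof -
  have "insert F \<Phi> \<in> Chains (face_le P)"
    using assms flag_Chain[OF assms(1)] flag_faces[OF assms(1)] by (auto simp: Chains_def)
  then show ?thesis using assms(1) by (auto simp: flags_def)
qed

lemma flag_contains_greatest:
  assumes "\<Phi> \<in> flags P" "F \<in> faces P" "\<And>G. G \<in> faces P \<Longrightarrow> (G, F) \<in> face_le P"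
  shows "F \<in> \<Phi>"
proof -
  have "insert F \<Phi> \<in> Chains (face_le P)"
    using assms flag_Chain[OF assms(1)] flag_faces[OF assms(1)] by (auto simp: Chains_def)
  then show ?thesis using assms(1) by (auto simp: flags_def)
qed

text \<open>Strict monotonicity of the rank leaves only the least face for rank -1 and only the
  greatest for rank \<open>n\<close>; by maximality both lie in every flag.\<close>

lemma improper_face_in_flag:
  assumes "\<Phi> \<in> flags P" "\<Psi> \<in> flags P" "F \<in> \<Phi>" "rk P F \<notin> ranks n"
  shows "F \<in> \<Psi>"
proof -
  have F: "F \<in> faces P" "rk P F \<in> {-1..n}" using assms flag_faces rk_bounds by blast+
  consider "rk P F = -1" | "rk P F = n" using F assms(4) by fastforce
  then show ?thesis
  proof cases
    case 1
    obtain B where B: "B \<in> faces P" "\<forall>G \<in> faces P. (B, G) \<in> face_le P"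
      using polytope by (auto simp: polytope_def)
    then have "B = F" using 1 F rk_less rk_bounds by fastforce
    then show ?thesis using B flag_contains_least assms by blast
  next
    case 2
    obtain B where B: "B \<in> faces P" "\<forall>G \<in> faces P. (G, B) \<in> face_le P"
      using polytope by (auto simp: polytope_def)
    then have "B = F" using 2 F rk_less rk_bounds by fastforce
    then show ?thesis using B flag_contains_greatest assms by blast
  qed
qed

section \<open>Adjacent flags and the diamond condition\<close>

definition i_adjacent :: "int \<Rightarrow> 'a set \<Rightarrow> 'a set \<Rightarrow> bool" where
  "i_adjacent i \<Phi> \<Psi> \<longleftrightarrow>
     \<Psi> \<in> flags P \<and> \<Psi> \<noteq> \<Phi> \<and> {F \<in> \<Psi>. rk P F \<noteq> i} = {F \<in> \<Phi>. rk P F \<noteq> i}"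

lemma adj_flag_eq_The: "adj_flag P \<Phi> i = (THE \<Psi>. i_adjacent i \<Phi> \<Psi>)"
  by (simp add: adj_flag_def i_adjacent_def)

text \<open>The diamond condition, applied to the faces of ranks \<open>i - 1\<close> and
  \<open>i + 1\<close> of \<Phi>, leaves exactly one alternative to the face of rank
  \<open>i\<close>. This makes the description in \<open>adj_flag\<close> well defined.\<close>

lemma i_adjacent_ex1:
  assumes \<Phi>: "\<Phi> \<in> flags P" and i: "i \<in> ranks n"
  shows "\<exists>!\<Psi>. i_adjacent i \<Phi> \<Psi>"
proof -
  obtain A where A: "A \<in> \<Phi>" "rk P A = i - 1" using flag_face_exists[OF \<Phi>, of "i - 1"] i by auto
  obtain B where B: "B \<in> \<Phi>" "rk P B = i + 1" using flag_face_exists[OF \<Phi>, of "i + 1"] i by auto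
  obtain F where F: "F \<in> \<Phi>" "rk P F = i" using flag_face_exists[OF \<Phi>, of i] i by auto
  let ?D = "{H \<in> faces P. face_less P A H \<and> face_less P H B}"
  have between: "\<exists>H. H \<in> \<Psi> \<and> rk P H = i \<and> H \<in> ?D"
    if "\<Psi> \<in> flags P" "A \<in> \<Psi>" "B \<in> \<Psi>" for \<Psi>
  proof -
    obtain H where H: "H \<in> \<Psi>" "rk P H = i" using flag_face_exists[OF \<open>\<Psi> \<in> flags P\<close>, of i] i by auto
    then have "face_less P A H" "face_less P H B"
      using A B that by (auto simp: face_less_def flag_le_iff)
    then show ?thesis using H that flag_faces by blast
  qed
  have FD: "F \<in> ?D" using between[OF \<Phi> A(1) B(1)] F flag_rk_unique[OF \<Phi>] by metis
  have "face_less P A B" using A B \<Phi> by (auto simp: face_less_def flag_le_iff)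
  then have "card ?D = 2"
    by (intro diamondD) (use A B flag_faces[OF \<Phi>] in auto)
  then have "card (?D - {F}) = 1" using FD by simp
  then obtain F' where F': "?D - {F} = {F'}" by (auto simp: card_1_singleton_iff)
  then have F'D: "F' \<in> ?D" and F'F: "F' \<noteq> F" by blast+
  have D: "?D = {F, F'}" using F' FD by blast
  have "rk P A < rk P F'" "rk P F' < rk P B" using F'D rk_less by (auto simp: face_less_def)
  then have rF': "rk P F' = i" using A B by simp
  let ?\<Psi> = "insert F' (\<Phi> - {F})"
  have F'\<Phi>: "F' \<notin> \<Phi>" using flag_rk_unique[OF \<Phi>] F rF' F'F by metis
  \<comment> \<open>Every face of \<Phi> other than \<open>F\<close> lies below \<open>A\<close> or
    above \<open>B\<close>, hence is comparable with \<open>F'\<close> by transitivity.\<close>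
  have cmp: "(G, F') \<in> face_le P \<or> (F', G) \<in> face_le P" if G: "G \<in> \<Phi>" "G \<noteq> F" for G
  proof (cases "rk P G < i")
    case True
    then have "(G, A) \<in> face_le P" using A G \<Phi> by (simp add: flag_le_iff)
    then show ?thesis using F'D le_trans by (auto simp: face_less_def)
  next
    case False
    then have "rk P G > i" using flag_rk_unique[OF \<Phi> G(1) F(1)] G F by fastforce
    then have "(B, G) \<in> face_le P" using B G \<Phi> by (simp add: flag_le_iff)
    then show ?thesis using F'D le_trans by (auto simp: face_less_def)
  qed
  have ch: "?\<Psi> \<in> Chains (face_le P)"
    using cmp flag_Chain[OF \<Phi>] le_refl F'D by (auto simp: Chains_def)
  have "finite \<Phi>" by (simp add: Chains_finite flag_Chain \<Phi>)
  then have "card ?\<Psi> = card \<Phi>" using F(1) F'\<Phi> card_Suc_Diff1[of \<Phi> F] by simp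
  then have "?\<Psi> \<in> flags P" using ch flag_card[OF \<Phi>] flagI by simp
  moreover have "{G \<in> ?\<Psi>. rk P G \<noteq> i} = {G \<in> \<Phi>. rk P G \<noteq> i}"
    using rF' F by auto
  ultimately have ex: "i_adjacent i \<Phi> ?\<Psi>" using F'\<Phi> by (auto simp: i_adjacent_def)
  \<comment> \<open>A competitor keeps \<open>A\<close> and \<open>B\<close>, whose ranks differ
    from \<open>i\<close>, so its face of rank \<open>i\<close> is \<open>F\<close> or
    \<open>F'\<close>; with \<open>F\<close> it would contain all of \<Phi>.\<close>
  have "\<Omega> = ?\<Psi>" if "i_adjacent i \<Phi> \<Omega>" for \<Omega>
  proof -
    have \<Omega>: "\<Omega> \<in> flags P" "\<Omega> \<noteq> \<Phi>" "\<And>G. rk P G \<noteq> i \<Longrightarrow> G \<in> \<Omega> \<longleftrightarrow> G \<in> \<Phi>"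
      using that by (auto simp: i_adjacent_def)
    obtain H where H: "H \<in> \<Omega>" "rk P H = i" "H \<in> ?D" using between \<Omega> A B by force
    have "H \<noteq> F"
    proof
      assume "H = F"
      then have "\<Phi> \<subseteq> \<Omega>" using \<Omega>(3) H F flag_rk_unique[OF \<Phi>] by (metis subsetI)
      then show False using flag_eqI \<Phi> \<Omega> by blast
    qed
    then have "H = F'" using H(3) unfolding D by blast
    moreover have "G \<in> \<Omega>" if "G \<in> \<Phi>" "G \<noteq> F" for G
      using \<Omega>(3) F flag_rk_unique[OF \<Phi>] that by metis
    ultimately have "?\<Psi> \<subseteq> \<Omega>" using H(1) by blast
    then show ?thesis using flag_eqI \<open>?\<Psi> \<in> flags P\<close> \<Omega>(1) by blast
  qed
  then show ?thesis using ex by blast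
qed

lemma i_adjacent_adj_flag:
  "\<Phi> \<in> flags P \<Longrightarrow> i \<in> ranks n \<Longrightarrow> i_adjacent i \<Phi> (adj_flag P \<Phi> i)"
  unfolding adj_flag_eq_The by (rule theI') (rule i_adjacent_ex1)

lemma adj_flag_eqI:
  "\<Phi> \<in> flags P \<Longrightarrow> i \<in> ranks n \<Longrightarrow> i_adjacent i \<Phi> \<Psi> \<Longrightarrow> adj_flag P \<Phi> i = \<Psi>"
  using i_adjacent_ex1 i_adjacent_adj_flag by blast

lemma adj_flag_flag: "\<Phi> \<in> flags P \<Longrightarrow> i \<in> ranks n \<Longrightarrow> adj_flag P \<Phi> i \<in> flags P"
  using i_adjacent_adj_flag i_adjacent_def by blast

lemma adj_flag_invol:
  "\<Phi> \<in> flags P \<Longrightarrow> i \<in> ranks n \<Longrightarrow> adj_flag P (adj_flag P \<Phi> i) i = \<Phi>"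
  using i_adjacent_adj_flag[of \<Phi> i] by (intro adj_flag_eqI) (auto simp: i_adjacent_def)

lemma adj_flag_mem:
  "\<Phi> \<in> flags P \<Longrightarrow> i \<in> ranks n \<Longrightarrow> rk P F \<noteq> i \<Longrightarrow> F \<in> adj_flag P \<Phi> i \<longleftrightarrow> F \<in> \<Phi>"
  using i_adjacent_adj_flag[of \<Phi> i] by (auto simp: i_adjacent_def)

section \<open>Words of ranks and strong flag-connectedness\<close>

lemma adj_flags_flag: "\<Phi> \<in> flags P \<Longrightarrow> set w \<subseteq> ranks n \<Longrightarrow> adj_flags P \<Phi> w \<in> flags P"
  by (induction w rule: rev_induct) (auto simp: adj_flags_def intro!: adj_flag_flag)

lemma adj_flags_mem:
  "\<Phi> \<in> flags P \<Longrightarrow> set w \<subseteq> ranks n \<Longrightarrow> rk P F \<notin> set w \<Longrightarrow> F \<in> adj_flags P \<Phi> w \<longleftrightarrow> F \<in> \<Phi>"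
proof (induction w rule: rev_induct)
  case (snoc k w)
  then have "adj_flags P \<Phi> (w @ [k]) = adj_flag P (adj_flags P \<Phi> w) k"
    by (simp add: adj_flags_def)
  moreover have "adj_flags P \<Phi> w \<in> flags P" using snoc.prems by (simp add: adj_flags_flag)
  ultimately show ?case using snoc by (simp add: adj_flag_mem)
qed (simp add: adj_flags_def)

text \<open>\<open>adjacent\<close> does not mention ranks. The exchanged faces share a rank because
  a flag has exactly one face of each rank, and this rank lies in \<open>ranks n\<close> because
  improper faces belong to every flag.\<close>

lemma adjacent_imp_adj_flag:
  assumes \<Phi>: "\<Phi> \<in> flags P" and \<Psi>: "\<Psi> \<in> flags P" and adj: "adjacent \<Phi> \<Psi>"
  obtains i where "i \<in> ranks n" "i \<notin> rk P ` (\<Phi> \<inter> \<Psi>)" "\<Psi> = adj_flag P \<Phi> i"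
proof -
  obtain F F' where F: "\<Phi> - \<Psi> = {F}" and F': "\<Psi> - \<Phi> = {F'}"
    using adj by (auto simp: adjacent_def card_1_singleton_iff)
  have mem: "F \<in> \<Phi>" "F \<notin> \<Psi>" "F' \<in> \<Psi>" "F' \<notin> \<Phi>" using F F' by blast+
  let ?i = "rk P F"
  have i: "?i \<in> ranks n" using improper_face_in_flag \<Phi> \<Psi> mem by blast
  \<comment> \<open>Were this face in \<Phi>, it would equal \<open>F\<close>, which \<Psi> lacks;
    so it is the new face \<open>F'\<close>.\<close>
  obtain G where G: "G \<in> \<Psi>" "rk P G = ?i" using flag_face_exists[OF \<Psi>, of ?i] i by auto
  have "G \<notin> \<Phi>" using flag_rk_unique[OF \<Phi>] G mem by metis
  then have "G = F'" using G F' by blast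
  then have rF': "rk P F' = ?i" using G by simp
  have "G \<in> \<Psi> \<longleftrightarrow> G \<in> \<Phi>" if "rk P G \<noteq> ?i" for G
  proof -
    have "G \<noteq> F" "G \<noteq> F'" using that rF' by auto
    then show ?thesis using F F' by blast
  qed
  then have "{G \<in> \<Psi>. rk P G \<noteq> ?i} = {G \<in> \<Phi>. rk P G \<noteq> ?i}" by (intro Collect_cong) blast
  then have "i_adjacent ?i \<Phi> \<Psi>" using \<Psi> mem unfolding i_adjacent_def by blast
  moreover have "?i \<notin> rk P ` (\<Phi> \<inter> \<Psi>)" using flag_rk_unique[OF \<Phi>] mem by (metis IntE imageE)
  ultimately show thesis using that i adj_flag_eqI[OF \<Phi> i] by blast
qed

text \<open>Strong flag-connectedness, translated from paths of flags to words. The common faces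
  persist along the path, so no letter is the rank of one of them.\<close>

lemma flags_connected_by_word:
  assumes \<Phi>: "\<Phi> \<in> flags P" and \<Psi>: "\<Psi> \<in> flags P"
  obtains w where "set w \<subseteq> ranks n - rk P ` (\<Phi> \<inter> \<Psi>)" "adj_flags P \<Phi> w = \<Psi>"
proof -
  \<comment> \<open>The set \<open>S\<close> is decoupled from the endpoints: the head of the path
    changes in the induction, while the faces to be kept do not.\<close>
  have path: "\<exists>w. set w \<subseteq> ranks n - rk P ` S \<and> adj_flags P (hd \<Phi>s) w = last \<Phi>s"
    if "\<Phi>s \<noteq> []" "set \<Phi>s \<subseteq> flags P" "successively adjacent \<Phi>s" "\<forall>\<Omega> \<in> set \<Phi>s. S \<subseteq> \<Omega>" for \<Phi>s S
    using that
  proof (induction \<Phi>s rule: induct_list012)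
    case (2 \<Omega>)
    then show ?case by (intro exI[of _ "[]"]) (simp add: adj_flags_def)
  next
    case (3 \<Omega> \<Omega>' \<Phi>s)
    obtain w where w: "set w \<subseteq> ranks n - rk P ` S" "adj_flags P \<Omega>' w = last (\<Omega>' # \<Phi>s)"
      using 3 by force
    obtain i where i: "i \<in> ranks n" "i \<notin> rk P ` (\<Omega> \<inter> \<Omega>')" "\<Omega>' = adj_flag P \<Omega> i"
      using adjacent_imp_adj_flag[of \<Omega> \<Omega>'] "3.prems" by (metis insert_subset list.simps(15) successively.simps(3))
    have "i \<notin> rk P ` S" using i 3 by auto
    then show ?case using w i by (intro exI[of _ "i # w"]) (auto simp: adj_flags_def)
  qed simp
  have "strongly_flag_connected P" using polytope by (simp add: polytope_def)
  then obtain \<Phi>s where "\<Phi>s \<noteq> []" "set \<Phi>s \<subseteq> flags P" "hd \<Phi>s = \<Phi>" "last \<Phi>s = \<Psi>"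
    "successively adjacent \<Phi>s" "\<forall>\<Omega> \<in> set \<Phi>s. \<Phi> \<inter> \<Psi> \<subseteq> \<Omega>"
    using \<Phi> \<Psi> unfolding strongly_flag_connected_def by meson
  then show thesis using path[of \<Phi>s "\<Phi> \<inter> \<Psi>"] that by auto
qed

section \<open>Automorphisms and their action on flags\<close>

lemma Aut_bij: "\<gamma> \<in> carrier (Aut P) \<Longrightarrow> bij_betw \<gamma> (faces P) (faces P)"
  by (simp add: Aut_def Bij_def)

lemma Aut_inj: "\<gamma> \<in> carrier (Aut P) \<Longrightarrow> inj_on \<gamma> (faces P)"
  by (meson Aut_bij bij_betw_imp_inj_on)

lemma Aut_le_iff:
  "\<gamma> \<in> carrier (Aut P) \<Longrightarrow> F \<in> faces P \<Longrightarrow> G \<in> faces P \<Longrightarrow>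
     (\<gamma> F, \<gamma> G) \<in> face_le P \<longleftrightarrow> (F, G) \<in> face_le P"
  by (simp add: Aut_def)

lemma Aut_mult_apply: "F \<in> faces P \<Longrightarrow> (\<gamma> \<otimes>\<^bsub>Aut P\<^esub> \<delta>) F = \<delta> (\<gamma> F)"
  by (simp add: Aut_def compose_def)

lemma Aut_mult_image: "\<Phi> \<in> flags P \<Longrightarrow> (\<gamma> \<otimes>\<^bsub>Aut P\<^esub> \<delta>) ` \<Phi> = \<delta> ` \<gamma> ` \<Phi>"
  unfolding image_image by (rule image_cong) (simp_all add: flag_faces[THEN subsetD] Aut_mult_apply)

lemma Aut_one_apply: "F \<in> faces P \<Longrightarrow> \<one>\<^bsub>Aut P\<^esub> F = F"
  by (simp add: Aut_def)

lemma Aut_one_image: "\<Phi> \<in> flags P \<Longrightarrow> \<one>\<^bsub>Aut P\<^esub> ` \<Phi> = \<Phi>"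
  using flag_faces Aut_one_apply by (simp add: subset_iff)

lemma Aut_inv_apply:
  assumes "\<gamma> \<in> carrier (Aut P)" "F \<in> faces P" shows "(inv\<^bsub>Aut P\<^esub> \<gamma>) (\<gamma> F) = F"
  using assms Aut_mult_apply[of F \<gamma> "inv\<^bsub>Aut P\<^esub> \<gamma>"] group.r_inv[OF group_Aut]
  by (metis Aut_one_apply)

lemma Aut_flag:
  assumes \<gamma>: "\<gamma> \<in> carrier (Aut P)" and \<Phi>: "\<Phi> \<in> flags P" shows "\<gamma> ` \<Phi> \<in> flags P"
proof (rule flagI)
  show "\<gamma> ` \<Phi> \<in> Chains (face_le P)"
    using flag_Chain[OF \<Phi>] flag_faces[OF \<Phi>] Aut_le_iff[OF \<gamma>] unfolding Chains_def by blast
  have "card (\<gamma> ` \<Phi>) = card \<Phi>"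
    using card_image inj_on_subset Aut_inj[OF \<gamma>] flag_faces[OF \<Phi>] by blast
  then show "int (card (\<gamma> ` \<Phi>)) = n + 2" using flag_card[OF \<Phi>] by simp
qed

lemma face_in_flag: assumes "F \<in> faces P" obtains \<Phi> where "\<Phi> \<in> flags P" "F \<in> \<Phi>"
  using Chain_subset_flag[of "{F}"] le_refl[OF assms] by (auto simp: Chains_def)

text \<open>Recovers the rank from the order alone. The faces of \<Phi> up to \<open>F\<close> have
  the ranks from -1 to \<open>rk P F\<close>, which are \<open>rk P F + 2\<close> values.\<close>

lemma rk_eq_card_below:
  assumes \<Phi>: "\<Phi> \<in> flags P" and F: "F \<in> \<Phi>"
  shows "rk P F = int (card {G \<in> \<Phi>. (G, F) \<in> face_le P}) - 2"
proof -
  have r: "rk P F \<in> {-1..n}" using F \<Phi> flag_faces rk_bounds by blast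
  have "{G \<in> \<Phi>. (G, F) \<in> face_le P} = {G \<in> \<Phi>. rk P G \<le> rk P F}"
    using \<Phi> F by (auto simp: flag_le_iff)
  moreover have "rk P ` {G \<in> \<Phi>. rk P G \<le> rk P F} = {-1..rk P F}"
  proof -
    have "rk P ` {G \<in> \<Phi>. rk P G \<le> rk P F} = rk P ` \<Phi> \<inter> {..rk P F}" by auto
    then show ?thesis using flag_rk_image[OF \<Phi>] r by auto
  qed
  moreover have "inj_on (rk P) {G \<in> \<Phi>. rk P G \<le> rk P F}"
    using Chains_inj_rk[OF flag_Chain[OF \<Phi>]] by (rule inj_on_subset) auto
  ultimately have "card {G \<in> \<Phi>. (G, F) \<in> face_le P} = card {-1..rk P F}"
    by (metis card_image)
  then show ?thesis using r by simp
qed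

text \<open>\<open>Aut\<close> asks only for preservation of the order. An automorphism maps the
  part of a flag up to \<open>F\<close> bijectively onto the part of the image flag up to
  \<open>\<gamma> F\<close>, and these sizes determine the ranks.\<close>

lemma Aut_rk:
  assumes \<gamma>: "\<gamma> \<in> carrier (Aut P)" and F: "F \<in> faces P" shows "rk P (\<gamma> F) = rk P F"
proof -
  obtain \<Phi> where \<Phi>: "\<Phi> \<in> flags P" "F \<in> \<Phi>" using face_in_flag F .
  have "{G \<in> \<gamma> ` \<Phi>. (G, \<gamma> F) \<in> face_le P} = \<gamma> ` {G \<in> \<Phi>. (G, F) \<in> face_le P}"
    using Aut_le_iff[OF \<gamma>] F flag_faces[OF \<Phi>(1)] by blast
  moreover have "inj_on \<gamma> {G \<in> \<Phi>. (G, F) \<in> face_le P}"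
    using Aut_inj[OF \<gamma>] by (rule inj_on_subset) (use flag_faces[OF \<Phi>(1)] in auto)
  ultimately show ?thesis
    using rk_eq_card_below[OF \<Phi>] rk_eq_card_below[OF Aut_flag[OF \<gamma> \<Phi>(1)], of "\<gamma> F"] \<Phi>(2)
    by (simp add: card_image)
qed

lemma Aut_fixes_face:
  assumes "\<gamma> \<in> carrier (Aut P)" "\<Phi> \<in> flags P" "F \<in> \<Phi>" "F \<in> \<gamma> ` \<Phi>"
  shows "\<gamma> F = F"
proof (rule flag_rk_unique[OF Aut_flag[OF assms(1,2)]])
  show "rk P (\<gamma> F) = rk P F" using Aut_rk[OF assms(1)] flag_faces[OF assms(2)] assms(3) by blast
qed (use assms in auto)

text \<open>Automorphisms preserve flags, ranks and distinctness, hence \<open>i_adjacent\<close>;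
  uniqueness of the adjacent flag does the rest.\<close>

lemma Aut_adj_flag:
  assumes \<gamma>: "\<gamma> \<in> carrier (Aut P)" and \<Phi>: "\<Phi> \<in> flags P" and i: "i \<in> ranks n"
  shows "adj_flag P (\<gamma> ` \<Phi>) i = \<gamma> ` adj_flag P \<Phi> i"
proof (rule adj_flag_eqI[OF Aut_flag[OF \<gamma> \<Phi>] i])
  let ?\<Psi> = "adj_flag P \<Phi> i"
  have \<Psi>: "?\<Psi> \<in> flags P" "?\<Psi> \<noteq> \<Phi>" "{F \<in> ?\<Psi>. rk P F \<noteq> i} = {F \<in> \<Phi>. rk P F \<noteq> i}"
    using i_adjacent_adj_flag[OF \<Phi> i] by (auto simp: i_adjacent_def)
  have "\<gamma> ` ?\<Psi> \<noteq> \<gamma> ` \<Phi>"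
    using \<Psi>(1,2) inj_on_image_eq_iff[OF Aut_inj[OF \<gamma>]] flag_faces \<Phi> by metis
  moreover have img: "{F \<in> \<gamma> ` \<Omega>. rk P F \<noteq> i} = \<gamma> ` {F \<in> \<Omega>. rk P F \<noteq> i}" if "\<Omega> \<in> flags P" for \<Omega>
    using Aut_rk[OF \<gamma>] flag_faces[OF that] by (auto simp: subset_iff)
  ultimately show "i_adjacent i (\<gamma> ` \<Phi>) (\<gamma> ` ?\<Psi>)"
    using \<Psi> \<Phi> Aut_flag[OF \<gamma>] by (simp add: i_adjacent_def img)
qed

lemma Aut_adj_flags:
  assumes \<gamma>: "\<gamma> \<in> carrier (Aut P)" and \<Phi>: "\<Phi> \<in> flags P" and "set w \<subseteq> ranks n"
  shows "adj_flags P (\<gamma> ` \<Phi>) w = \<gamma> ` adj_flags P \<Phi> w"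
  using assms(3)
proof (induction w rule: rev_induct)
  case (snoc k w)
  then show ?case
    using Aut_adj_flag[OF \<gamma> adj_flags_flag[OF \<Phi>], of w k] by (simp add: adj_flags_def)
qed (simp add: adj_flags_def)

text \<open>Any face lies in a flag that some word reaches from \<Phi>. Automorphisms commute with
  words, so both have the same image of that flag, and within it the rank determines the image of
  the face.\<close>

lemma Aut_eqI:
  assumes \<gamma>: "\<gamma> \<in> carrier (Aut P)" and \<delta>: "\<delta> \<in> carrier (Aut P)"
    and \<Phi>: "\<Phi> \<in> flags P" and eq: "\<gamma> ` \<Phi> = \<delta> ` \<Phi>"
  shows "\<gamma> = \<delta>"
proof (rule extensionalityI)
  show "\<gamma> \<in> extensional (faces P)" "\<delta> \<in> extensional (faces P)"
    using \<gamma> \<delta> by (auto simp: Aut_def Bij_def)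
  fix F assume F: "F \<in> faces P"
  obtain \<Psi> where \<Psi>: "\<Psi> \<in> flags P" "F \<in> \<Psi>" using face_in_flag F .
  obtain w where w: "set w \<subseteq> ranks n - rk P ` (\<Phi> \<inter> \<Psi>)" "adj_flags P \<Phi> w = \<Psi>"
    using flags_connected_by_word[OF \<Phi> \<Psi>(1)] .
  then have "\<gamma> ` \<Psi> = \<delta> ` \<Psi>"
    using Aut_adj_flags[OF \<gamma> \<Phi>, of w] Aut_adj_flags[OF \<delta> \<Phi>, of w] eq by auto
  then have "\<delta> F \<in> \<gamma> ` \<Psi>" "\<gamma> F \<in> \<gamma> ` \<Psi>" using \<Psi> by auto
  then show "\<gamma> F = \<delta> F"
    using flag_rk_unique[OF Aut_flag[OF \<gamma> \<Psi>(1)]] Aut_rk[OF \<gamma> F] Aut_rk[OF \<delta> F] by metis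
qed

section \<open>Orbits of flags\<close>

lemma orbit_image: "\<Psi> \<in> orbit (Aut P) (`) \<Phi> \<longleftrightarrow> (\<exists>\<gamma> \<in> carrier (Aut P). \<gamma> ` \<Phi> = \<Psi>)"
  by (auto simp: orbit_def)

lemma orbit_cong:
  assumes "\<Phi> \<in> flags P" "\<Psi> \<in> orbit (Aut P) (`) \<Phi>"
  shows "orbit (Aut P) (`) \<Psi> = orbit (Aut P) (`) \<Phi>"
proof -
  interpret group "Aut P" by (rule group_Aut)
  obtain \<gamma> where \<gamma>: "\<gamma> \<in> carrier (Aut P)" "\<gamma> ` \<Phi> = \<Psi>" using assms by (auto simp: orbit_image)
  have "(inv\<^bsub>Aut P\<^esub> \<gamma>) ` \<Psi> = \<Phi>"
    using Aut_inv_apply[OF \<gamma>(1)] flag_faces[OF assms(1)] unfolding \<gamma>(2)[symmetric] image_image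
    by (simp add: subset_iff)
  moreover have "\<Psi> \<in> flags P" using \<gamma> Aut_flag assms by blast
  ultimately have "\<delta> ` \<Psi> = (\<gamma> \<otimes>\<^bsub>Aut P\<^esub> \<delta>) ` \<Phi>" "\<delta> ` \<Phi> = (inv\<^bsub>Aut P\<^esub> \<gamma> \<otimes>\<^bsub>Aut P\<^esub> \<delta>) ` \<Psi>" for \<delta>
    using assms(1) \<gamma>(2) by (simp_all only: Aut_mult_image)
  then have "\<Omega> \<in> orbit (Aut P) (`) \<Psi> \<longleftrightarrow> \<Omega> \<in> orbit (Aut P) (`) \<Phi>" for \<Omega>
    unfolding orbit_image using \<gamma>(1) m_closed inv_closed by metis
  then show ?thesis by blast
qed

text \<open>Existence is membership in the orbit and uniqueness is \<open>Aut_eqI\<close>, so the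
  description in \<open>aut_to\<close> denotes.\<close>

lemma aut_to:
  assumes "\<Phi> \<in> flags P" "\<Psi> \<in> orbit (Aut P) (`) \<Phi>"
  shows "aut_to P \<Phi> \<Psi> \<in> carrier (Aut P) \<and> aut_to P \<Phi> \<Psi> ` \<Phi> = \<Psi>"
proof -
  have "\<exists>!\<gamma>. \<gamma> \<in> carrier (Aut P) \<and> \<gamma> ` \<Phi> = \<Psi>"
    using assms Aut_eqI unfolding orbit_image by metis
  from theI'[OF this] show ?thesis by (simp add: aut_to_def)
qed

section \<open>Stabilizers of faces of the base flag\<close>

definition face_stabilizer :: "'a set \<Rightarrow> int set \<Rightarrow> ('a \<Rightarrow> 'a) set" where
  "face_stabilizer \<Phi> J = {\<gamma> \<in> carrier (Aut P). \<forall>F \<in> \<Phi>. rk P F \<in> J \<longrightarrow> \<gamma> F = F}"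

lemma face_stabilizer_Int:
  "face_stabilizer \<Phi> J \<inter> face_stabilizer \<Phi> K = face_stabilizer \<Phi> (J \<union> K)"
  by (auto simp: face_stabilizer_def)

lemma face_stabilizer_subgroup:
  assumes "\<Phi> \<in> flags P" shows "subgroup (face_stabilizer \<Phi> J) (Aut P)"
proof -
  interpret group "Aut P" by (rule group_Aut)
  have F: "F \<in> faces P" if "F \<in> \<Phi>" for F using that flag_faces assms by blast
  show ?thesis
  proof
    fix \<gamma> assume "\<gamma> \<in> face_stabilizer \<Phi> J"
    then show "inv\<^bsub>Aut P\<^esub> \<gamma> \<in> face_stabilizer \<Phi> J"
      using F Aut_inv_apply by (auto simp: face_stabilizer_def) (metis)
  qed (auto simp: face_stabilizer_def F Aut_mult_apply Aut_one_apply)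
qed

text \<open>Letters outside \<open>J\<close> leave the faces with rank in \<open>J\<close> in place,
  so these lie in both \<Phi> and its image, and \<open>Aut_fixes_face\<close> applies. All three
  kinds of generators have this form.\<close>

lemma aut_to_face_stabilizer:
  assumes \<Phi>: "\<Phi> \<in> flags P" and w: "set w \<subseteq> ranks n - J"
    and orb: "adj_flags P \<Phi> w \<in> orbit (Aut P) (`) \<Phi>"
  shows "aut_to P \<Phi> (adj_flags P \<Phi> w) \<in> face_stabilizer \<Phi> J"
proof -
  let ?\<gamma> = "aut_to P \<Phi> (adj_flags P \<Phi> w)"
  have \<gamma>: "?\<gamma> \<in> carrier (Aut P)" "?\<gamma> ` \<Phi> = adj_flags P \<Phi> w" using aut_to[OF \<Phi> orb] by auto
  have "?\<gamma> F = F" if "F \<in> \<Phi>" "rk P F \<in> J" for F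
  proof (rule Aut_fixes_face[OF \<gamma>(1) \<Phi> that(1)])
    show "F \<in> ?\<gamma> ` \<Phi>" unfolding \<gamma>(2) using adj_flags_mem[OF \<Phi>, of w F] that w by blast
  qed
  then show ?thesis using \<gamma> by (simp add: face_stabilizer_def)
qed

end

section \<open>Change of orbit in a two-orbit polytope\<close>

locale two_orbit_polytope_class = abstract_polytope n P
  for n :: int and P :: "'a ranked_poset" +
  fixes I :: "int set"
  assumes in_class: "in_class_2 n P I"
begin

lemma I_ranks: "I \<subseteq> ranks n"
  using in_class by (auto simp: in_class_2_def)

lemma adj_flag_orbit_iff:
  "\<Phi> \<in> flags P \<Longrightarrow> i \<in> ranks n \<Longrightarrow> adj_flag P \<Phi> i \<in> orbit (Aut P) (`) \<Phi> \<longleftrightarrow> i \<in> I"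
  using in_class unfolding in_class_2_def by blast

lemma orbit_self: "\<Phi> \<in> flags P \<Longrightarrow> \<Phi> \<in> orbit (Aut P) (`) \<Phi>"
  using group.is_monoid[OF group_Aut, THEN monoid.one_closed] Aut_one_image
  unfolding orbit_image by blast

text \<open>Otherwise the three flags would have pairwise distinct orbits.\<close>

lemma two_orbits:
  assumes "\<Phi> \<in> flags P" "\<Psi> \<in> flags P" "\<Omega> \<in> flags P"
    and "\<Psi> \<notin> orbit (Aut P) (`) \<Phi>" "\<Omega> \<notin> orbit (Aut P) (`) \<Psi>"
  shows "\<Omega> \<in> orbit (Aut P) (`) \<Phi>"
proof (rule ccontr)
  let ?O = "orbit (Aut P) (`)"
  assume "\<Omega> \<notin> ?O \<Phi>"
  then have three: "card {?O \<Phi>, ?O \<Psi>, ?O \<Omega>} = 3" using assms orbit_self by (auto simp: card_insert_if)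
  have sub: "{?O \<Phi>, ?O \<Psi>, ?O \<Omega>} \<subseteq> orbits (Aut P) (flags P) (`)"
    using assms by (auto simp: orbits_def)
  have two: "card (orbits (Aut P) (flags P) (`)) = 2"
    using in_class by (simp add: in_class_2_def two_orbit_polytope_def)
  then have "finite (orbits (Aut P) (flags P) (`))" using card.infinite by fastforce
  from card_mono[OF this sub] show False using two three by linarith
qed

lemma rho_orbit:
  assumes "\<Phi> \<in> flags P" "i \<in> I" shows "adj_flags P \<Phi> [i] \<in> orbit (Aut P) (`) \<Phi>"
  using assms adj_flag_orbit_iff I_ranks by (auto simp: adj_flags_def)

text \<open>Since \<open>I\<close> is the same for all flags, each of the two letters changes the
  orbit, and the second change leads back.\<close>

lemma alpha2_orbit:
  assumes \<Phi>: "\<Phi> \<in> flags P" and j: "j \<in> ranks n - I" and k: "k \<in> ranks n - I"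
  shows "adj_flags P \<Phi> [j, k] \<in> orbit (Aut P) (`) \<Phi>"
proof -
  have "adj_flag P \<Phi> j \<in> flags P" using \<Phi> j by (simp add: adj_flag_flag)
  moreover from this have "adj_flag P (adj_flag P \<Phi> j) k \<in> flags P" using k by (simp add: adj_flag_flag)
  ultimately show ?thesis
    using two_orbits[of \<Phi> "adj_flag P \<Phi> j"] adj_flag_orbit_iff \<Phi> j k by (simp add: adj_flags_def)
qed

text \<open>The letter \<open>i\<close> keeps the orbit and each \<open>j\<close> changes it, so the
  orbit changes exactly twice.\<close>

lemma alpha3_orbit:
  assumes \<Phi>: "\<Phi> \<in> flags P" and j: "j \<in> ranks n - I" and i: "i \<in> I"
  shows "adj_flags P \<Phi> [j, i, j] \<in> orbit (Aut P) (`) \<Phi>"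
proof -
  let ?\<Psi> = "adj_flag P \<Phi> j" and ?\<Omega> = "adj_flag P (adj_flag P \<Phi> j) i"
  have i': "i \<in> ranks n" using i I_ranks by blast
  have \<Psi>: "?\<Psi> \<in> flags P" using \<Phi> j by (simp add: adj_flag_flag)
  then have \<Omega>: "?\<Omega> \<in> flags P" using i' by (simp add: adj_flag_flag)
  then have \<Xi>: "adj_flag P ?\<Omega> j \<in> flags P" using j by (simp add: adj_flag_flag)
  have "orbit (Aut P) (`) ?\<Omega> = orbit (Aut P) (`) ?\<Psi>"
    using orbit_cong[OF \<Psi>] adj_flag_orbit_iff[OF \<Psi> i'] i by blast
  then show ?thesis
    using two_orbits[OF \<Phi> \<Psi> \<Xi>] adj_flag_orbit_iff[OF \<Phi>] adj_flag_orbit_iff[OF \<Omega>] j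
    by (simp add: adj_flags_def)
qed

section \<open>The generated subgroups as stabilizers\<close>

lemma Gamma_lower_subset_face_stabilizer:
  assumes \<Phi>: "\<Phi> \<in> flags P"
  shows "Gamma_lower n P I \<Phi> J \<subseteq> face_stabilizer \<Phi> J"
  unfolding Gamma_lower_def Let_def
proof (rule group.generate_subgroup_incl[OF group_Aut _ face_stabilizer_subgroup[OF \<Phi>]], safe)
  fix i assume "i \<in> I" "i \<in> ranks n" "i \<notin> J"
  then show "rho P \<Phi> i \<in> face_stabilizer \<Phi> J"
    using aut_to_face_stabilizer[OF \<Phi> _ rho_orbit[OF \<Phi> \<open>i \<in> I\<close>], of J]
    by (simp add: rho_def adj_flags_def)
next
  fix j k assume "j \<in> ranks n" "j \<notin> I" "j \<notin> J" "k \<in> ranks n" "k \<notin> I" "k \<notin> J"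
  then show "alpha2 P \<Phi> j k \<in> face_stabilizer \<Phi> J"
    unfolding alpha2_def by (intro aut_to_face_stabilizer alpha2_orbit \<Phi>) auto
next
  fix j i assume "j \<in> ranks n" "j \<notin> I" "j \<notin> J" "i \<in> I" "i \<in> ranks n" "i \<notin> J"
  then show "alpha3 P \<Phi> j i \<in> face_stabilizer \<Phi> J"
    unfolding alpha3_def by (intro aut_to_face_stabilizer alpha3_orbit \<Phi>) auto
qed

lemma Gamma_lower_mult:
  "\<gamma> \<in> Gamma_lower n P I \<Phi> J \<Longrightarrow> \<delta> \<in> Gamma_lower n P I \<Phi> J \<Longrightarrow>
     \<gamma> \<otimes>\<^bsub>Aut P\<^esub> \<delta> \<in> Gamma_lower n P I \<Phi> J"
  by (simp add: Gamma_lower_def Let_def generate.eng)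

text \<open>A word may end outside the orbit of \<Phi>, where no image of \<Phi> lies. The second
  alternative supplies a representative \<Phi>^j for such flags, with \<open>j\<close> depending on
  the word, so that the induction can continue.\<close>

lemma word_flag_cases:
  assumes \<Phi>: "\<Phi> \<in> flags P" and w: "set w \<subseteq> ranks n - J"
  shows "\<exists>\<gamma> \<in> Gamma_lower n P I \<Phi> J. adj_flags P \<Phi> w = \<gamma> ` \<Phi> \<or>
           (\<exists>j \<in> ranks n - I - J. adj_flags P \<Phi> w = \<gamma> ` adj_flag P \<Phi> j)"
  using w
proof (induction w rule: rev_induct)
  case Nil
  have "\<one>\<^bsub>Aut P\<^esub> \<in> Gamma_lower n P I \<Phi> J" by (simp add: Gamma_lower_def Let_def generate.one)
  then show ?case using Aut_one_image[OF \<Phi>] by (force simp: adj_flags_def)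
next
  case (snoc k w)
  let ?G = "Gamma_lower n P I \<Phi> J"
  have k: "k \<in> ranks n" "k \<notin> J" using snoc.prems by auto
  have last: "adj_flags P \<Phi> (w @ [k]) = adj_flag P (adj_flags P \<Phi> w) k"
    by (simp add: adj_flags_def)
  obtain \<gamma> where \<gamma>: "\<gamma> \<in> ?G" and
    cases: "adj_flags P \<Phi> w = \<gamma> ` \<Phi> \<or>
              (\<exists>j \<in> ranks n - I - J. adj_flags P \<Phi> w = \<gamma> ` adj_flag P \<Phi> j)"
    using snoc by auto
  have \<gamma>A: "\<gamma> \<in> carrier (Aut P)"
    using Gamma_lower_subset_face_stabilizer[OF \<Phi>] \<gamma> by (auto simp: face_stabilizer_def)
  from cases consider (id) "adj_flags P \<Phi> w = \<gamma> ` \<Phi>"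
    | (adj) j where "j \<in> ranks n - I - J" "adj_flags P \<Phi> w = \<gamma> ` adj_flag P \<Phi> j" by blast
  then show ?case
  proof cases
    case id
    \<comment> \<open>Appending \<open>k\<close> commutes with \<gamma>, so it acts on the
      representative. The flag \<Phi>^k is the image of \<Phi> under \<open>rho P \<Phi> k\<close>
      if \<open>k\<close> is in \<open>I\<close>, and otherwise itself a representative of the
      second kind.\<close>
    then have eq: "adj_flags P \<Phi> (w @ [k]) = \<gamma> ` adj_flag P \<Phi> k"
      using Aut_adj_flag[OF \<gamma>A \<Phi> k(1)] last by simp
    show ?thesis
    proof (cases "k \<in> I")
      case True
      have "rho P \<Phi> k \<in> ?G"
        unfolding Gamma_lower_def Let_def using True k by (intro generate.incl) blast
      moreover have "rho P \<Phi> k ` \<Phi> = adj_flag P \<Phi> k"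
        using aut_to[OF \<Phi> rho_orbit[OF \<Phi> True]] by (simp add: rho_def adj_flags_def)
      ultimately show ?thesis
        using eq \<gamma> Gamma_lower_mult Aut_mult_image[OF \<Phi>] by metis
    qed (use eq \<gamma> k in blast)
  next
    case (adj j)
    let ?\<Psi> = "adj_flag P \<Phi> j"
    have j: "j \<in> ranks n - I" "j \<in> ranks n" "j \<notin> J" using adj by auto
    have \<Psi>: "?\<Psi> \<in> flags P" using \<Phi> j by (simp add: adj_flag_flag)
    have eq: "adj_flags P \<Phi> (w @ [k]) = \<gamma> ` adj_flag P ?\<Psi> k"
      using Aut_adj_flag[OF \<gamma>A \<Psi> k(1)] last adj by simp
    show ?thesis
    proof (cases "k \<in> I")
      case True
      have \<alpha>G: "alpha3 P \<Phi> j k \<in> ?G"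
        unfolding Gamma_lower_def Let_def using True k j by (intro generate.incl) blast
      have \<alpha>: "alpha3 P \<Phi> j k \<in> carrier (Aut P)"
        "alpha3 P \<Phi> j k ` \<Phi> = adj_flag P (adj_flag P ?\<Psi> k) j"
        using aut_to[OF \<Phi> alpha3_orbit[OF \<Phi> j(1) True]] by (simp_all add: alpha3_def adj_flags_def)
      \<comment> \<open>Pass to the j-adjacent flags in \<open>\<alpha>(2)\<close>: on the left this
        commutes with the automorphism, on the right it cancels the final letter
        \<open>j\<close>.\<close>
      have "alpha3 P \<Phi> j k ` ?\<Psi> = adj_flag P ?\<Psi> k"
        using Aut_adj_flag[OF \<alpha>(1) \<Phi> j(2)] \<alpha>(2) adj_flag_invol adj_flag_flag \<Psi> k j by simp
      \<comment> \<open>Products are read from left to right, so the new generator comes before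
        \<gamma>; the representative \<Phi>^j stays the same.\<close>
      then have "adj_flags P \<Phi> (w @ [k]) = (alpha3 P \<Phi> j k \<otimes>\<^bsub>Aut P\<^esub> \<gamma>) ` ?\<Psi>"
        using eq Aut_mult_image[OF \<Psi>] by simp
      then show ?thesis using Gamma_lower_mult[OF \<alpha>G \<gamma>] adj(1) by blast
    next
      case False
      then have kI: "k \<in> ranks n - I" using k by simp
      \<comment> \<open>The letter \<open>k\<close> leads back to the orbit of \<Phi>: the generator
        absorbs \<open>j\<close> and \<open>k\<close> together, and the first alternative
        holds.\<close>
      have "alpha2 P \<Phi> j k \<in> ?G"
        unfolding Gamma_lower_def Let_def using kI k j by (intro generate.incl) blast
      moreover have "alpha2 P \<Phi> j k ` \<Phi> = adj_flag P ?\<Psi> k"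
        using aut_to[OF \<Phi> alpha2_orbit[OF \<Phi> j(1) kI]] by (simp add: alpha2_def adj_flags_def)
      ultimately show ?thesis
        using eq \<gamma> Gamma_lower_mult Aut_mult_image[OF \<Phi>] by metis
    qed
  qed
qed

lemma Gamma_lower_eq_face_stabilizer:
  assumes \<Phi>: "\<Phi> \<in> flags P" and J: "J \<subseteq> ranks n"
  shows "Gamma_lower n P I \<Phi> J = face_stabilizer \<Phi> J"
proof
  show "face_stabilizer \<Phi> J \<subseteq> Gamma_lower n P I \<Phi> J"
  proof
    fix \<gamma> assume "\<gamma> \<in> face_stabilizer \<Phi> J"
    then have \<gamma>: "\<gamma> \<in> carrier (Aut P)" and fix\<gamma>: "\<And>F. F \<in> \<Phi> \<Longrightarrow> rk P F \<in> J \<Longrightarrow> \<gamma> F = F"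
      by (auto simp: face_stabilizer_def)
    obtain w where w: "set w \<subseteq> ranks n - rk P ` (\<Phi> \<inter> \<gamma> ` \<Phi>)" "adj_flags P \<Phi> w = \<gamma> ` \<Phi>"
      using flags_connected_by_word[OF \<Phi> Aut_flag[OF \<gamma> \<Phi>]] .
    \<comment> \<open>The face of rank \<open>j\<close> in \<Phi> is fixed by \<gamma>, hence common
      to both flags; so the word avoids \<open>J\<close>.\<close>
    have "j \<in> rk P ` (\<Phi> \<inter> \<gamma> ` \<Phi>)" if j: "j \<in> J" for j
    proof -
      have "j \<in> {-1..n}" using J j by auto
      then obtain F where F: "F \<in> \<Phi>" "rk P F = j" by (rule flag_face_exists[OF \<Phi>])
      then show ?thesis using fix\<gamma>[of F] j by (metis IntI imageI)
    qed
    then have "set w \<subseteq> ranks n - J" using w by blast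
    then obtain \<delta> where \<delta>: "\<delta> \<in> Gamma_lower n P I \<Phi> J" and
      cases: "\<gamma> ` \<Phi> = \<delta> ` \<Phi> \<or> (\<exists>j \<in> ranks n - I - J. \<gamma> ` \<Phi> = \<delta> ` adj_flag P \<Phi> j)"
      using word_flag_cases[OF \<Phi>, of w J] w by auto
    have \<delta>A: "\<delta> \<in> carrier (Aut P)"
      using Gamma_lower_subset_face_stabilizer[OF \<Phi>] \<delta> by (auto simp: face_stabilizer_def)
    \<comment> \<open>As \<gamma> and \<delta> are automorphisms, the equation would put \<Phi>^j
      into the orbit of \<Phi>, although \<open>j\<close> is outside \<open>I\<close>.\<close>
    have False if j: "j \<in> ranks n - I" and eq: "\<gamma> ` \<Phi> = \<delta> ` adj_flag P \<Phi> j" for j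
    proof -
      have "adj_flag P \<Phi> j \<in> flags P" using adj_flag_flag \<Phi> j by blast
      then have "orbit (Aut P) (`) (adj_flag P \<Phi> j) = orbit (Aut P) (`) (\<gamma> ` \<Phi>)"
        unfolding eq by (rule orbit_cong[symmetric]) (use \<delta>A in \<open>auto simp: orbit_image\<close>)
      also have "\<dots> = orbit (Aut P) (`) \<Phi>"
        using \<gamma> by (intro orbit_cong \<Phi>) (auto simp: orbit_image)
      finally show False
        using adj_flag_orbit_iff[OF \<Phi>] orbit_self \<open>adj_flag P \<Phi> j \<in> flags P\<close> j by blast
    qed
    then have "\<gamma> ` \<Phi> = \<delta> ` \<Phi>" using cases by blast
    then show "\<gamma> \<in> Gamma_lower n P I \<Phi> J" using Aut_eqI[OF \<gamma> \<delta>A \<Phi>] \<delta> by simp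
  qed
qed (rule Gamma_lower_subset_face_stabilizer[OF \<Phi>])

end

theorem theorem4:
  fixes P :: "'a ranked_poset" and n :: int and I J K :: "int set" and \<Phi> :: "'a set"
  assumes "in_class_2 n P I"
    and "\<Phi> \<in> flags P"
    and "J \<subseteq> ranks n"
    and "K \<subseteq> ranks n"
  shows "Gamma_lower n P I \<Phi> J \<inter> Gamma_lower n P I \<Phi> K = Gamma_lower n P I \<Phi> (J \<union> K) \<and>
         Gamma_upper n P I \<Phi> J \<inter> Gamma_upper n P I \<Phi> K = Gamma_upper n P I \<Phi> (J \<inter> K)"
proof -
  interpret two_orbit_polytope_class n P I
    using assms(1) by unfold_locales (auto simp: in_class_2_def two_orbit_polytope_def)
  \<comment> \<open>Stated for arbitrary sets of ranks in order to be applied also to the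
    complements of \<open>J\<close> and \<open>K\<close>; by de Morgan's law this second instance is
    the identity for \<open>Gamma_upper\<close>.\<close>
  have lower: "Gamma_lower n P I \<Phi> A \<inter> Gamma_lower n P I \<Phi> B = Gamma_lower n P I \<Phi> (A \<union> B)"
    if "A \<subseteq> ranks n" "B \<subseteq> ranks n" for A B
    using that assms(2) by (simp add: Gamma_lower_eq_face_stabilizer face_stabilizer_Int)
  show ?thesis
    using lower[OF assms(3,4)] lower[of "ranks n - J" "ranks n - K"]
    by (simp add: Gamma_upper_def Diff_Int)
qed

end
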